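(* Let $L>0$, and let $T^*>0$ be a solution of the equation $$\frac{T_r}{\overline{F}(T_r)}\cdot\frac{d\overline{F}(T_r)}{dT_r} - \ln\overline{F}(T_r) - 2\ln\rho = 0$$ in the unknown $T_r>0$. Then $T^*$ is the optimal rejuvenation period: it maximizes the reliability $$R(L,T_r) = \rho^{2\left(\frac{L}{T_r}-1\right)}\cdot\overline{F}(T_r)^{\frac{L}{T_r}}$$ over all $T_r>0$.
   Context: A system operates on the time interval $[0,L]$ ($L>0$ is its longevity) and is rejuvenated periodically with period $T_r>0$; each rejuvenation involves two task migrations, each succeeding with constant probability $\rho\in(0,1]$. The transient failure rate is a continuous function $\lambda:[0,\infty)\to[0,\infty)$ with $\lambda(0)=0$ that is strictly increasing in time, and $\overline{F}(t) = e^{-\int_0^t\lambda(x)\,dx}$. The (worst-case) system reliability is taken to be the function $R(L,T_r)$ displayed in the claim, regarded as a function of a continuous real variable $T_r>0$. *)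

theory Defs
  imports "HOL-Analysis.Analysis"
begin

text \<open>The failure rate \<open>lam\<close> is a total function on the reals; only its values on \<open>[0, \<infinity>)\<close> matter.\<close>

definition survival :: "(real \<Rightarrow> real) \<Rightarrow> real \<Rightarrow> real" where
  "survival lam t = exp (- integral {0..t} lam)"

definition reliability :: "real \<Rightarrow> (real \<Rightarrow> real) \<Rightarrow> real \<Rightarrow> real \<Rightarrow> real" where
  "reliability \<rho> lam L T = \<rho> powr (2 * (L / T - 1)) * survival lam T powr (L / T)"

end

(* With H(T) the integral of lam over [0,T], ln R(L,T) = -2 ln rho - L (H(T) - 2 ln rho) / T, and
   the equation for Tstar says (H(Tstar) - 2 ln rho) / Tstar = lam(Tstar). Since H' = lam is
   increasing, H is convex, and its tangent at Tstar gives H(T) - 2 ln rho \<ge> lam(Tstar) T. *)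
theory Submission
  imports Defs
begin

lemma integral_has_real_derivative_interior:
  fixes f :: "real \<Rightarrow> real"
  assumes "continuous_on {a..} f" and "a < t"
  shows "((\<lambda>u. integral {a..u} f) has_real_derivative f t) (at t)"
proof -
  \<comment> \<open>The right end \<open>t + 1\<close> is any point beyond \<open>t\<close>: it
    makes \<open>t\<close> interior to the interval, so the derivative within the interval becomes
    two-sided.\<close>
  have "continuous_on {a..t + 1} f"
    by (rule continuous_on_subset[OF assms(1)]) auto
  then have "((\<lambda>u. integral {a..u} f) has_real_derivative f t) (at t within {a..t + 1})"
    by (rule integral_has_real_derivative) (use assms(2) in auto)
  then show ?thesis
    using assms(2) by (simp add: at_within_Icc_at)
qed

text \<open>The integral has the nondecreasing derivative \<open>f\<close>. The half-line is open
  because at \<open>a\<close> itself a two-sided derivative need not exist.\<close>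

lemma convex_on_integral_of_mono:
  fixes f :: "real \<Rightarrow> real"
  assumes "continuous_on {a..} f" and "mono_on {a..} f"
  shows "convex_on {a<..} (\<lambda>t. integral {a..t} f)"
proof (rule convex_on_realI)
  show "((\<lambda>t. integral {a..t} f) has_real_derivative f x) (at x)" if "x \<in> {a<..}" for x
    using integral_has_real_derivative_interior[OF assms(1)] that by simp
  show "f x \<le> f y" if "x \<in> {a<..}" "y \<in> {a<..}" "x \<le> y" for x y
    using mono_onD[OF assms(2)] that by simp
qed simp

lemma deriv_survival:
  assumes "continuous_on {0..} lam" and "0 < t"
  shows "deriv (survival lam) t = - lam t * survival lam t"
proof -
  have "((\<lambda>t. exp (- integral {0..t} lam)) has_real_derivative
      - lam t * exp (- integral {0..t} lam)) (at t)"
    by (auto intro!: derivative_eq_intros integral_has_real_derivative_interior[OF assms])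
  then have "(survival lam has_real_derivative - lam t * survival lam t) (at t)"
    by (simp add: survival_def[abs_def])
  then show ?thesis
    by (rule DERIV_imp_deriv)
qed

text \<open>Isolates the dependence on \<open>T\<close> in a single quotient: for L > 0, maximizing
  the reliability amounts to minimizing that quotient.\<close>

lemma reliability_eq_exp:
  assumes "0 < \<rho>" and "0 < T"
  shows "reliability \<rho> lam L T
    = exp (- 2 * ln \<rho> - L * ((integral {0..T} lam - 2 * ln \<rho>) / T))"
  using assms
  by (simp add: reliability_def survival_def powr_def field_simps flip: exp_add)

theorem mainTheorem3:
  fixes lam :: "real \<Rightarrow> real" and \<rho> L Tstar :: real
  assumes "0 < \<rho>" and "\<rho> \<le> 1"
    and "continuous_on {0..} lam"
    and "\<And>t. 0 \<le> t \<Longrightarrow> 0 \<le> lam t"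
    and "lam 0 = 0"
    and "strict_mono_on {0..} lam"
    and "0 < L"
    and "0 < Tstar"
    and "Tstar / survival lam Tstar * deriv (survival lam) Tstar
           - ln (survival lam Tstar) - 2 * ln \<rho> = 0"
  shows "is_arg_max (reliability \<rho> lam L) (\<lambda>T. 0 < T) Tstar"
proof -
  let ?H = "\<lambda>t. integral {0..t} lam"
  \<comment> \<open>Allows the factor \<open>survival lam Tstar\<close> of the derivative to cancel
    against the denominator in the equation.\<close>
  have "survival lam Tstar \<noteq> 0"
    by (simp add: survival_def)
  then have "- Tstar * lam Tstar - ln (survival lam Tstar) - 2 * ln \<rho> = 0"
    using assms(9) deriv_survival[OF assms(3,8)] by simp
  then have crit: "?H Tstar - 2 * ln \<rho> = lam Tstar * Tstar"
    by (simp add: survival_def algebra_simps)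
  have "reliability \<rho> lam L T \<le> reliability \<rho> lam L Tstar" if "0 < T" for T
  proof -
    have "convex_on {0<..} ?H"
      using convex_on_integral_of_mono[OF assms(3)] strict_mono_on_imp_mono_on[OF assms(6)] .
    moreover have "(?H has_real_derivative lam Tstar) (at Tstar within {0<..})"
      using integral_has_real_derivative_interior[OF assms(3,8)]
      by (rule has_field_derivative_at_within)
    ultimately have "lam Tstar * (T - Tstar) \<le> ?H T - ?H Tstar"
      using assms(8) that by (intro convex_on_imp_above_tangent) (auto simp: interior_open)
    \<comment> \<open>By \<open>crit\<close>, the tangent to \<open>?H\<close> at
      \<open>Tstar\<close> has intercept 2 ln \<rho> at 0.\<close>
    then have "lam Tstar * T \<le> ?H T - 2 * ln \<rho>"
      using crit by (simp add: algebra_simps)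
    \<comment> \<open>The left quotient equals \<open>lam Tstar\<close> by \<open>crit\<close>; the
      right one is at least that after division by T > 0.\<close>
    then have "(?H Tstar - 2 * ln \<rho>) / Tstar \<le> (?H T - 2 * ln \<rho>) / T"
      using assms(8) that crit by (simp add: pos_le_divide_eq)
    then have "L * ((?H Tstar - 2 * ln \<rho>) / Tstar) \<le> L * ((?H T - 2 * ln \<rho>) / T)"
      using assms(7) by (intro mult_left_mono) auto
    then show ?thesis
      using assms(1,8) that by (simp add: reliability_eq_exp)
  qed
  then show ?thesis
    using assms(8) by (simp add: is_arg_max_linorder)
qed

end
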